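(* For all positive integers $n,k,m$ with $k+m\not\equiv 2\pmod 3$, \[ \det\left(\mu^{\le k+m-1}_{n+i+j+2m-2}(\mathbf{1},\mathbf{1})\right)_{i,j=0}^{k-1} =(-1)^{n\lfloor (k+m)/3\rfloor}\det\left(\mu^{\le k+m-1}_{-n-i-j}(\mathbf{1},\mathbf{1})\right)_{i,j=0}^{m-1}. \]
   Context: Let $\mathbf{b}=(b_i)_{i\ge0}$, $\boldsymbol{\lambda}=(\lambda_i)_{i\ge1}$ be sequences. A Motzkin path is a finite sequence of points in $\mathbb{Z}\times\mathbb{Z}_{\ge0}$ whose steps are each $(1,1)$, $(1,0)$ or $(1,-1)$. Its weight is the product of $b_i$ over horizontal steps starting at height $i$ and of $\lambda_i$ over down steps starting at height $i$. For $K\ge 0$ and $N\ge 0$, $\mu^{\le K}_N(\mathbf{b},\boldsymbol{\lambda})$ is the sum of weights of Motzkin paths from $(0,0)$ to $(N,0)$ staying weakly below the line $y=K$. Here $\mathbf{1}=(1,1,\dots)$, so $\mu^{\le K}_N(\mathbf{1},\mathbf{1})$ is the number of such paths. Negative indices: if a sequence $(f_N)_{N\ge0}$ satisfies a recurrence $f_N=c_1f_{N-1}+\cdots+c_df_{N-d}$ for all $N\ge d$ with $c_d\ne0$, it is extended uniquely to all $N\in\mathbb{Z}$ so that the recurrence holds for all $N\in\mathbb{Z}$ (the extension is independent of the chosen recurrence); $\mu^{\le K}_{-N}$ denotes the values of this extension (they exist in the situation of the claim). *)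

theory Defs
  imports Complex_Main "Jordan_Normal_Form.Determinant"
begin

fun motzkin_step :: "int \<times> nat \<Rightarrow> int \<times> nat \<Rightarrow> bool" where
  "motzkin_step (x, h) (x', h') \<longleftrightarrow> x' = x + 1 \<and> (h' = h + 1 \<or> h' = h \<or> h = h' + 1)"

text \<open>A path is the nonempty list of the points it visits; the single point is the path of length 0.\<close>

definition motzkin_path :: "(int \<times> nat) list \<Rightarrow> bool" where
  "motzkin_path p \<longleftrightarrow> p \<noteq> [] \<and> successively motzkin_step p"

text \<open>Down steps start at height at least 1, so the value \<open>lam 0\<close> is never used.\<close>

fun step_weight :: "(nat \<Rightarrow> 'a::comm_ring_1) \<Rightarrow> (nat \<Rightarrow> 'a) \<Rightarrow> int \<times> nat \<Rightarrow> int \<times> nat \<Rightarrow> 'a" where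
  "step_weight b lam (x, h) (x', h') = (if h' = h then b h else if h' < h then lam h else 1)"

definition path_weight :: "(nat \<Rightarrow> 'a::comm_ring_1) \<Rightarrow> (nat \<Rightarrow> 'a) \<Rightarrow> (int \<times> nat) list \<Rightarrow> 'a" where
  "path_weight b lam p = (\<Prod>i<length p - 1. step_weight b lam (p ! i) (p ! Suc i))"

definition bounded_motzkin_paths :: "nat \<Rightarrow> nat \<Rightarrow> (int \<times> nat) list set" where
  "bounded_motzkin_paths K N =
     {p. motzkin_path p \<and> hd p = (0, 0) \<and> last p = (int N, 0) \<and> (\<forall>(x, h)\<in>set p. h \<le> K)}"

definition bounded_mu :: "nat \<Rightarrow> (nat \<Rightarrow> 'a::comm_ring_1) \<Rightarrow> (nat \<Rightarrow> 'a) \<Rightarrow> nat \<Rightarrow> 'a" where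
  "bounded_mu K b lam N = (\<Sum>p\<in>bounded_motzkin_paths K N. path_weight b lam p)"

text \<open>The sum ranges over a finite set, so it is not 0 by convention.\<close>

lemma motzkin_path_bounds:
  assumes "successively motzkin_step p" "p \<noteq> []"
  shows "fst (last p) = fst (hd p) + int (length p) - 1 \<and>
         (\<forall>q\<in>set p. fst (hd p) \<le> fst q \<and> fst q \<le> fst (last p))"
  using assms
proof (induction p)
  case (Cons a p)
  show ?case
  proof (cases p)
    case (Cons c r)
    then have "motzkin_step a c" "successively motzkin_step p"
      using Cons.prems by (auto simp: successively_Cons)
    moreover have "fst c = fst a + 1"
      using \<open>motzkin_step a c\<close> by (cases a; cases c) auto
    moreover have "c \<in> set p" "hd p = c" "last (a # p) = last p"
      using Cons by auto
    moreover have "fst (last p) = fst c + int (length p) - 1"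
      "\<forall>q\<in>set p. fst c \<le> fst q \<and> fst q \<le> fst (last p)"
      using Cons.IH \<open>successively motzkin_step p\<close> Cons by auto
    ultimately show ?thesis
      by fastforce
  qed simp
qed simp

lemma finite_bounded_motzkin_paths: "finite (bounded_motzkin_paths K N)"
proof (rule finite_subset)
  let ?A = "{0..int N} \<times> {..K}"
  show "bounded_motzkin_paths K N \<subseteq> {p. set p \<subseteq> ?A \<and> length p \<le> Suc N}"
  proof
    fix p assume p: "p \<in> bounded_motzkin_paths K N"
    have *: "successively motzkin_step p" "p \<noteq> []" "hd p = (0, 0)" "last p = (int N, 0)"
      "\<forall>(x, h)\<in>set p. h \<le> K"
      using p by (auto simp: bounded_motzkin_paths_def motzkin_path_def)
    have "int (length p) = int N + 1" "\<forall>q\<in>set p. 0 \<le> fst q \<and> fst q \<le> int N"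
      using motzkin_path_bounds[OF *(1,2)] *(3,4) by auto
    with *(5) show "p \<in> {p. set p \<subseteq> ?A \<and> length p \<le> Suc N}"
      by fastforce
  qed
  show "finite {p. set p \<subseteq> ?A \<and> length p \<le> Suc N}"
    by (rule finite_lists_length_le) simp
qed

definition recurrent_extension :: "(nat \<Rightarrow> 'a::field) \<Rightarrow> (int \<Rightarrow> 'a) \<Rightarrow> bool" where
  "recurrent_extension f g \<longleftrightarrow> (\<forall>N. g (int N) = f N) \<and>
     (\<exists>d\<ge>1. \<exists>c. c d \<noteq> 0 \<and>
        (\<forall>N\<ge>d. f N = (\<Sum>i=1..d. c i * f (N - i))) \<and>
        (\<forall>N. g N = (\<Sum>i=1..d. c i * g (N - int i))))"

text \<open>Independence of the extension from the chosen recurrence.\<close>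

lemma recurrence_backwards_zero:
  fixes h :: "int \<Rightarrow> 'a::field"
  assumes d: "d \<ge> 1" "c d \<noteq> 0" and rec: "\<And>N. h N = (\<Sum>i=1..d. c i * h (N - int i))"
    and zero: "\<And>N. N \<ge> M \<Longrightarrow> h N = 0"
  shows "h N = 0"
proof -
  have "\<forall>N \<ge> M - int k. h N = 0" for k
  proof (induction k)
    case (Suc k)
    define L where "L = M - int (Suc k)"
    have "0 = h (L + int d)"
      using Suc d by (simp add: L_def)
    also have "\<dots> = (\<Sum>i=1..d. c i * h (L + int d - int i))"
      by (rule rec)
    also have "\<dots> = (\<Sum>i=1..d. if i = d then c d * h L else 0)"
      using Suc by (intro sum.cong) (auto simp: L_def)
    also have "\<dots> = c d * h L"
      using d by simp
    finally have "h L = 0"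
      using d(2) by (metis mult_eq_0_iff)
    show ?case
    proof (intro allI impI)
      fix N assume "N \<ge> M - int (Suc k)"
      then have "N = L \<or> N \<ge> M - int k" by (auto simp: L_def)
      then show "h N = 0" using \<open>h L = 0\<close> Suc by blast
    qed
  qed (use zero in simp)
  from this[of "nat (M - N)"] show ?thesis by simp
qed

lemma recurrent_extension_unique:
  assumes "recurrent_extension f g" "recurrent_extension f g'"
  shows "g = g'"
proof -
  obtain d c where d: "d \<ge> 1" "c d \<noteq> 0" "\<forall>N\<ge>d. f N = (\<Sum>i=1..d. c i * f (N - i))"
    "\<And>N. g N = (\<Sum>i=1..d. c i * g (N - int i))"
    using assms(1) by (auto simp: recurrent_extension_def)
  obtain e a where e: "e \<ge> 1" "a e \<noteq> 0" "\<And>N. g' N = (\<Sum>i=1..e. a i * g' (N - int i))"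
    using assms(2) unfolding recurrent_extension_def by blast
  have f: "g (int N) = f N" "g' (int N) = f N" for N
    using assms by (auto simp: recurrent_extension_def)
  define h where "h N = g' N - (\<Sum>i=1..d. c i * g' (N - int i))" for N
  have "h N = 0" for N
  proof (rule recurrence_backwards_zero[of e a h "int d"])
    fix N
    have "(\<Sum>i=1..d. c i * g' (N - int i)) =
          (\<Sum>i=1..d. \<Sum>j=1..e. a j * (c i * g' (N - int j - int i)))"
    proof (rule sum.cong)
      fix i
      show "c i * g' (N - int i) = (\<Sum>j=1..e. a j * (c i * g' (N - int j - int i)))"
        unfolding e(3)[of "N - int i"] sum_distrib_left
        by (intro sum.cong) (simp_all add: mult.left_commute diff_diff_eq add.commute)
    qed simp
    also have "\<dots> = (\<Sum>j=1..e. \<Sum>i=1..d. a j * (c i * g' (N - int j - int i)))"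
      by (rule sum.swap)
    finally show "h N = (\<Sum>j=1..e. a j * h (N - int j))"
      using e(3)[of N]
      by (simp add: h_def right_diff_distrib sum_subtractf sum_distrib_left)
  next
    fix N assume N: "N \<ge> int d"
    define n where "n = nat N"
    have n: "N = int n" "d \<le> n" using N by (auto simp: n_def)
    have "(\<Sum>i=1..d. c i * g' (N - int i)) = (\<Sum>i=1..d. c i * f (n - i))"
      by (intro sum.cong) (use n in \<open>auto simp flip: f(2) of_nat_diff\<close>)
    also have "\<dots> = g' N"
      using d(3) n f(2) by metis
    finally show "h N = 0" by (simp add: h_def)
  qed (use e(1,2) in auto)
  then have g': "g' N = (\<Sum>i=1..d. c i * g' (N - int i))" for N
    unfolding h_def right_minus_eq .
  have "g N - g' N = 0" for N
  proof (rule recurrence_backwards_zero[of d c "\<lambda>N. g N - g' N" 0])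
    fix N
    show "g N - g' N = (\<Sum>i=1..d. c i * (g (N - int i) - g' (N - int i)))"
      using d(4)[of N] g'[of N] by (simp only: right_diff_distrib sum_subtractf)
  next
    fix N :: int assume "N \<ge> 0"
    then show "g N - g' N = 0" using f[of "nat N"] by simp
  qed (use d(1,2) in auto)
  then show ?thesis by (intro ext) (simp only: right_minus_eq)
qed

text \<open>The extension to all integers; unspecified when no recurrence with \<open>c d \<noteq> 0\<close> exists.\<close>

definition int_extension :: "(nat \<Rightarrow> 'a::field) \<Rightarrow> int \<Rightarrow> 'a" where
  "int_extension f = (THE g. recurrent_extension f g)"

definition bounded_mu_int :: "nat \<Rightarrow> (nat \<Rightarrow> 'a::field) \<Rightarrow> (nat \<Rightarrow> 'a) \<Rightarrow> int \<Rightarrow> 'a" where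
  "bounded_mu_int K b lam = int_extension (bounded_mu K b lam)"

end

theory Submission
  imports Defs
begin

text \<open>
  Let \<open>A\<close> be the tridiagonal matrix of size \<open>s = k + m\<close> whose entries on the three diagonals are 1.
  Then \<open>\<mu>\<^sub>N = (A\<^sup>N)\<^sub>0\<^sub>0\<close>, also for negative \<open>N\<close>, since \<open>det A = (-1)\<^bsup>s div 3\<^esup>\<close> unless \<open>s \<equiv> 2 (mod 3)\<close>.
  The vectors \<open>A\<^sup>i e\<^sub>0\<close> are unitriangular in the standard basis, so with \<open>B = A\<^bsup>n+2m-2\<^esup>\<close> the left-hand
  Hankel determinant is the leading principal \<open>k\<close>-minor of \<open>B\<close>, while the right-hand one is, after
  reversing rows and columns, the leading principal \<open>m\<close>-minor of the inverse of \<open>B\<close>. By Jacobi's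
  complementary minor theorem the latter is the trailing \<open>k\<close>-minor of \<open>B\<close> divided by \<open>det B\<close>, and
  leading and trailing minors of \<open>B\<close> agree because \<open>A\<close> is invariant under reversing the order of the
  basis.
\<close>

section \<open>Determinants and powers of matrices\<close>

lemma index_mult_mat_sum:
  assumes "A \<in> carrier_mat n l" "B \<in> carrier_mat l p" "i < n" "j < p"
  shows "(A * B) $$ (i, j) = (\<Sum>c<l. A $$ (i, c) * B $$ (c, j))"
  using assms by (auto simp: scalar_prod_def atLeast0LessThan intro!: sum.cong)

lemma pow_mat_add:
  fixes A :: "'a::semiring_1 mat"
  assumes "A \<in> carrier_mat n n"
  shows "A ^\<^sub>m (i + j) = A ^\<^sub>m i * A ^\<^sub>m j"
proof (induction j)
  case (Suc j)
  then show ?case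
    using assms by (simp add: assoc_mult_mat[of _ n n _ n _ n])
qed (use assms in simp)

lemma pow_mat_Suc_left:
  fixes A :: "'a::semiring_1 mat"
  assumes "A \<in> carrier_mat n n"
  shows "A ^\<^sub>m Suc i = A * A ^\<^sub>m i"
  using pow_mat_add[OF assms, of 1 i] assms by simp

text \<open>With its mirror image it replaces the exponent law for integer powers: each factor
  \<open>A\<close> meets the leftmost factor \<open>B\<close> and cancels.\<close>

lemma pow_mat_cancel_left:
  fixes A B :: "'a::semiring_1 mat"
  assumes A: "A \<in> carrier_mat n n" and B: "B \<in> carrier_mat n n" and AB: "A * B = 1\<^sub>m n"
    and "i \<le> r"
  shows "A ^\<^sub>m i * B ^\<^sub>m r = B ^\<^sub>m (r - i)"
  using \<open>i \<le> r\<close>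
proof (induction i)
  case (Suc i)
  have "A ^\<^sub>m Suc i * B ^\<^sub>m r = A * (A ^\<^sub>m i * B ^\<^sub>m r)"
    using A B by (simp only: pow_mat_Suc_left[OF A]) (simp add: assoc_mult_mat[of _ n n _ n _ n])
  also have "A ^\<^sub>m i * B ^\<^sub>m r = B ^\<^sub>m Suc (r - Suc i)"
    using Suc by (simp add: Suc_diff_Suc del: pow_mat.simps)
  also have "A * \<dots> = (A * B) * B ^\<^sub>m (r - Suc i)"
    using A B by (simp only: pow_mat_Suc_left[OF B]) (simp add: assoc_mult_mat[of _ n n _ n _ n])
  finally show ?case
    using B by (simp add: AB)
qed (use A B in simp)

lemma pow_mat_cancel_right:
  fixes A B :: "'a::semiring_1 mat"
  assumes A: "A \<in> carrier_mat n n" and B: "B \<in> carrier_mat n n" and BA: "B * A = 1\<^sub>m n"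
    and "i \<le> r"
  shows "B ^\<^sub>m r * A ^\<^sub>m i = B ^\<^sub>m (r - i)"
  using \<open>i \<le> r\<close>
proof (induction i)
  case (Suc i)
  have "B ^\<^sub>m r * A ^\<^sub>m Suc i = (B ^\<^sub>m r * A ^\<^sub>m i) * A"
    using A B by (simp add: assoc_mult_mat[of _ n n _ n _ n])
  also have "B ^\<^sub>m r * A ^\<^sub>m i = B ^\<^sub>m Suc (r - Suc i)"
    using Suc by (simp add: Suc_diff_Suc del: pow_mat.simps)
  also have "\<dots> * A = B ^\<^sub>m (r - Suc i) * (B * A)"
    using A B by (simp add: assoc_mult_mat[of _ n n _ n _ n])
  finally show ?case
    using B by (simp add: BA)
qed (use A B in simp)

lemma det_pow_mat:
  fixes A :: "'a::comm_ring_1 mat"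
  assumes "A \<in> carrier_mat n n"
  shows "det (A ^\<^sub>m i) = det A ^ i"
  using assms by (induction i) (simp_all add: det_mult[of _ n] mult.commute)

lemma transpose_pow_mat:
  fixes A :: "'a::comm_semiring_1 mat"
  assumes "A \<in> carrier_mat n n"
  shows "transpose_mat (A ^\<^sub>m i) = transpose_mat A ^\<^sub>m i"
proof (induction i)
  case (Suc i)
  have "transpose_mat (A ^\<^sub>m Suc i) = transpose_mat A * transpose_mat (A ^\<^sub>m i)"
    using assms by (simp add: transpose_mult[of _ n n _ n])
  then show ?case
    using Suc pow_mat_Suc_left[of "transpose_mat A" n i] assms by simp
qed (use assms in simp)

text \<open>Conjugation by the reversal permutation matrix \<open>J\<close>. As \<open>J\<close> is
  an involution, \<open>det J\<close> squares to 1, whatever its sign.\<close>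

lemma det_reverse:
  fixes f :: "nat \<Rightarrow> nat \<Rightarrow> 'a::comm_ring_1"
  shows "det (mat n n (\<lambda>(i, j). f (n - Suc i) (n - Suc j))) = det (mat n n (\<lambda>(i, j). f i j))"
proof -
  define J :: "'a mat" where "J = mat n n (\<lambda>(i, j). if j = n - Suc i then 1 else 0)"
  define M where "M = mat n n (\<lambda>(i, j). f i j)"
  have J: "J \<in> carrier_mat n n" and M: "M \<in> carrier_mat n n"
    by (simp_all add: J_def M_def)
  have left: "(J * X) $$ (i, j) = X $$ (n - Suc i, j)"
    if "X \<in> carrier_mat n n" "i < n" "j < n" for X i j
  proof -
    have "(J * X) $$ (i, j) = (\<Sum>c<n. if c = n - Suc i then X $$ (c, j) else 0)"
      unfolding index_mult_mat_sum[OF J that] by (intro sum.cong) (use that in \<open>auto simp: J_def\<close>)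
    then show ?thesis
      using that by simp
  qed
  have right: "(X * J) $$ (i, j) = X $$ (i, n - Suc j)"
    if "X \<in> carrier_mat n n" "i < n" "j < n" for X i j
  proof -
    have "(X * J) $$ (i, j) = (\<Sum>c<n. if c = n - Suc j then X $$ (i, c) else 0)"
      unfolding index_mult_mat_sum[OF that(1) J that(2,3)]
      by (intro sum.cong) (use that in \<open>auto simp: J_def\<close>)
    then show ?thesis
      using that by simp
  qed
  have "J * J = 1\<^sub>m n"
  proof (rule eq_matI)
    fix i j assume "i < dim_row (1\<^sub>m n :: 'a mat)" "j < dim_col (1\<^sub>m n :: 'a mat)"
    then have ij: "i < n" "j < n" by simp_all
    show "(J * J) $$ (i, j) = 1\<^sub>m n $$ (i, j)"
      unfolding left[OF J ij] using ij by (auto simp: J_def)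
  qed (use J in auto)
  then have "det J * det J = 1"
    using det_mult[OF J J] by simp
  moreover have "mat n n (\<lambda>(i, j). f (n - Suc i) (n - Suc j)) = J * M * J"
  proof (rule eq_matI)
    fix i j assume "i < dim_row (J * M * J)" "j < dim_col (J * M * J)"
    then have ij: "i < n" "j < n" using J by simp_all
    have JM: "J * M \<in> carrier_mat n n" using J M by simp
    show "mat n n (\<lambda>(i, j). f (n - Suc i) (n - Suc j)) $$ (i, j) = (J * M * J) $$ (i, j)"
      using ij
      by (simp only: right[OF JM ij] left[OF M]) (simp add: left[OF M] M_def del: index_mult_mat(1))
  qed (use J in auto)
  moreover have "det (J * M * J) = (det J * det J) * det M"
    using det_mult[OF J M] det_mult[of "J * M" n J] J M by (simp add: ac_simps)
  ultimately show ?thesis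
    by (simp add: M_def)
qed

text \<open>Stack the first \<open>m\<close> rows of \<open>C\<close> on the last \<open>k\<close>
  rows of the identity to get \<open>E\<close>. Since \<open>C * B\<close> is the identity,
  \<open>E * B\<close> is block lower triangular with diagonal blocks an identity and the trailing
  block of \<open>B\<close>, while \<open>E\<close> is block upper triangular with diagonal blocks
  the leading block of \<open>C\<close> and an identity. Compare determinants.\<close>

lemma jacobi_complementary_minor:
  fixes B C :: "'a::idom mat"
  assumes B: "B \<in> carrier_mat (m + k) (m + k)" and C: "C \<in> carrier_mat (m + k) (m + k)"
    and CB: "C * B = 1\<^sub>m (m + k)"
  shows "det (mat m m (\<lambda>(i, j). C $$ (i, j))) * det B =
         det (mat k k (\<lambda>(i, j). B $$ (m + i, m + j)))"
proof -
  define E where "E = four_block_mat (mat m m (\<lambda>(i, j). C $$ (i, j)))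
    (mat m k (\<lambda>(i, j). C $$ (i, m + j))) (0\<^sub>m k m) (1\<^sub>m k)"
  have E: "E \<in> carrier_mat (m + k) (m + k)"
    by (simp add: E_def)
  have E_index: "E $$ (i, j) = (if i < m then C $$ (i, j) else if i = j then 1 else 0)"
    if "i < m + k" "j < m + k" for i j
    using that by (auto simp: E_def)
  have "E * B = four_block_mat (1\<^sub>m m) (0\<^sub>m m k) (mat k m (\<lambda>(i, j). B $$ (m + i, j)))
    (mat k k (\<lambda>(i, j). B $$ (m + i, m + j)))" (is "_ = ?F")
  proof (rule eq_matI)
    fix i j assume "i < dim_row ?F" "j < dim_col ?F"
    then have ij: "i < m + k" "j < m + k" by simp_all
    have "(E * B) $$ (i, j) = (\<Sum>c<m + k. E $$ (i, c) * B $$ (c, j))"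
      by (rule index_mult_mat_sum[OF E B ij])
    also have "\<dots> = (if i < m then (C * B) $$ (i, j) else B $$ (i, j))"
    proof (cases "i < m")
      case True
      then show ?thesis
        unfolding index_mult_mat_sum[OF C B ij] by (simp add: E_index)
    next
      case False
      then have "(\<Sum>c<m + k. E $$ (i, c) * B $$ (c, j)) =
          (\<Sum>c<m + k. if c = i then B $$ (c, j) else 0)"
        using ij by (intro sum.cong) (auto simp: E_index)
      with False ij show ?thesis by simp
    qed
    finally show "(E * B) $$ (i, j) = ?F $$ (i, j)"
      using ij by (auto simp: CB)
  qed (use B E in auto)
  then have "det E * det B = det (mat k k (\<lambda>(i, j). B $$ (m + i, m + j)))"
    using det_mult[OF E B] det_four_block_mat_upper_right_zero[of "1\<^sub>m m" m "0\<^sub>m m k" k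
      "mat k m (\<lambda>(i, j). B $$ (m + i, j))" "mat k k (\<lambda>(i, j). B $$ (m + i, m + j))"] by simp
  moreover have "det E = det (mat m m (\<lambda>(i, j). C $$ (i, j)))"
    unfolding E_def by (subst det_four_block_mat_lower_left_zero) auto
  ultimately show ?thesis by simp
qed

section \<open>Powers of tridiagonal matrices\<close>

text \<open>Right multiplication by \<open>A\<close> moves an entry of a row at most one column to
  the right, and by exactly one column with factor 1. From the first unit row, \<open>n\<close>
  factors thus reach column \<open>n\<close> with entry 1 and nothing beyond.\<close>

lemma hessenberg_pow_row:
  fixes A :: "'a::semiring_1 mat"
  assumes A: "A \<in> carrier_mat s s"
    and zero: "\<And>i j. i < s \<Longrightarrow> j < s \<Longrightarrow> Suc i < j \<Longrightarrow> A $$ (i, j) = 0"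
    and one: "\<And>i. Suc i < s \<Longrightarrow> A $$ (i, Suc i) = 1"
    and "a < s" "n \<le> a"
  shows "(A ^\<^sub>m n) $$ (0, a) = (if a = n then 1 else 0)"
  using \<open>a < s\<close> \<open>n \<le> a\<close>
proof (induction n arbitrary: a)
  case 0
  then show ?case using A by simp
next
  case (Suc n)
  have "(A ^\<^sub>m Suc n) $$ (0, a) = (\<Sum>c<s. (A ^\<^sub>m n) $$ (0, c) * A $$ (c, a))"
    using Suc.prems A by (simp only: pow_mat.simps) (rule index_mult_mat_sum, auto)
  \<comment> \<open>Terms with \<open>c < n\<close> vanish because \<open>Suc c < a\<close>, those
    with \<open>c > n\<close> by the induction hypothesis.\<close>
  also have "\<dots> = (\<Sum>c<s. if c = n then A $$ (n, a) else 0)"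
  proof (rule sum.cong)
    fix c assume "c \<in> {..<s}"
    then show "(A ^\<^sub>m n) $$ (0, c) * A $$ (c, a) = (if c = n then A $$ (n, a) else 0)"
      using Suc zero[of c a] by (cases "c < n") auto
  qed simp
  also have "\<dots> = (if a = Suc n then 1 else 0)"
    using Suc.prems zero[of n a] one[of n] by auto
  finally show ?case .
qed

text \<open>The rows and columns of index 0 of the powers of \<open>A\<close> form unitriangular matrices.\<close>

lemma det_krylov:
  fixes A M :: "'a::comm_ring_1 mat"
  assumes A: "A \<in> carrier_mat s s" and sym: "transpose_mat A = A"
    and zero: "\<And>i j. i < s \<Longrightarrow> j < s \<Longrightarrow> Suc i < j \<Longrightarrow> A $$ (i, j) = 0"
    and one: "\<And>i. Suc i < s \<Longrightarrow> A $$ (i, Suc i) = 1"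
    and M: "M \<in> carrier_mat s s" and "t \<le> s"
  shows "det (mat t t (\<lambda>(i, j). (A ^\<^sub>m i * M * A ^\<^sub>m j) $$ (0, 0))) =
         det (mat t t (\<lambda>(i, j). M $$ (i, j)))"
proof -
  define U where "U = mat t t (\<lambda>(i, a). (A ^\<^sub>m i) $$ (0, a))"
  define N where "N = mat t t (\<lambda>(i, j). M $$ (i, j))"
  have U: "U \<in> carrier_mat t t" and N: "N \<in> carrier_mat t t"
    by (simp_all add: U_def N_def)
  have row: "(A ^\<^sub>m n) $$ (0, a) = (if a = n then 1 else 0)" if "a < s" "n \<le> a" for n a
    using hessenberg_pow_row[OF A zero one that] .
  \<comment> \<open>Powers of a symmetric matrix are symmetric, so the right-hand factor will be the
    transpose of \<open>U\<close>.\<close>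
  have col: "(A ^\<^sub>m n) $$ (a, 0) = (A ^\<^sub>m n) $$ (0, a)" if "a < s" for n a
  proof -
    have "transpose_mat (A ^\<^sub>m n) = A ^\<^sub>m n"
      using transpose_pow_mat[OF A] sym by simp
    moreover have "transpose_mat (A ^\<^sub>m n) $$ (0, a) = (A ^\<^sub>m n) $$ (a, 0)"
      using that A by simp
    ultimately show ?thesis by simp
  qed
  have "det U = prod_list (diag_mat U)"
    using U row \<open>t \<le> s\<close> by (intro det_lower_triangular[where n = t]) (auto simp: U_def)
  also have "\<dots> = 1"
    using row \<open>t \<le> s\<close> by (auto simp: prod_list_diag_prod U_def intro!: prod.neutral)
  finally have "det U = 1" .
  \<comment> \<open>For \<open>i < t\<close> the row is supported in the first \<open>t\<close>
    columns, so only the leading \<open>t\<close> by \<open>t\<close> block of \<open>M\<close>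
    contributes.\<close>
  have restrict: "(\<Sum>c<s. (A ^\<^sub>m i) $$ (0, c) * f c) = (\<Sum>c<t. (A ^\<^sub>m i) $$ (0, c) * f c)"
    if "i < t" for i f
    by (rule sum.mono_neutral_right) (use that \<open>t \<le> s\<close> row in auto)
  have "(A ^\<^sub>m i * M * A ^\<^sub>m j) $$ (0, 0) = (U * N * transpose_mat U) $$ (i, j)"
    if ij: "i < t" "j < t" for i j
  proof -
    have "s > 0" using ij \<open>t \<le> s\<close> by simp
    have "(A ^\<^sub>m i * M * A ^\<^sub>m j) $$ (0, 0) =
          (\<Sum>b<s. (A ^\<^sub>m i * M) $$ (0, b) * (A ^\<^sub>m j) $$ (b, 0))"
      using A M \<open>s > 0\<close> by (intro index_mult_mat_sum[of _ s]) auto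
    also have "\<dots> = (\<Sum>b<s. (A ^\<^sub>m j) $$ (0, b) * (\<Sum>a<s. (A ^\<^sub>m i) $$ (0, a) * M $$ (a, b)))"
    proof (rule sum.cong)
      fix b assume "b \<in> {..<s}"
      moreover have "(A ^\<^sub>m i * M) $$ (0, b) = (\<Sum>a<s. (A ^\<^sub>m i) $$ (0, a) * M $$ (a, b))"
        using A M \<open>s > 0\<close> calculation by (intro index_mult_mat_sum[of _ s]) auto
      ultimately show "(A ^\<^sub>m i * M) $$ (0, b) * (A ^\<^sub>m j) $$ (b, 0) =
          (A ^\<^sub>m j) $$ (0, b) * (\<Sum>a<s. (A ^\<^sub>m i) $$ (0, a) * M $$ (a, b))"
        by (simp only: col lessThan_iff mult.commute)
    qed simp
    also have "\<dots> = (\<Sum>b<t. (A ^\<^sub>m j) $$ (0, b) * (\<Sum>a<t. (A ^\<^sub>m i) $$ (0, a) * M $$ (a, b)))"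
      using ij by (simp only: restrict)
    also have "\<dots> = (\<Sum>b<t. (U * N) $$ (i, b) * transpose_mat U $$ (b, j))"
    proof (rule sum.cong)
      fix b assume b: "b \<in> {..<t}"
      have "(U * N) $$ (i, b) = (\<Sum>a<t. U $$ (i, a) * N $$ (a, b))"
        using U N ij b by (intro index_mult_mat_sum) auto
      also have "\<dots> = (\<Sum>a<t. (A ^\<^sub>m i) $$ (0, a) * M $$ (a, b))"
        using ij b by (simp add: U_def N_def)
      finally show "(A ^\<^sub>m j) $$ (0, b) * (\<Sum>a<t. (A ^\<^sub>m i) $$ (0, a) * M $$ (a, b)) =
          (U * N) $$ (i, b) * transpose_mat U $$ (b, j)"
        using ij b by (simp add: U_def mult.commute)
    qed simp
    also have "\<dots> = (U * N * transpose_mat U) $$ (i, j)"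
      using U N ij by (intro index_mult_mat_sum[symmetric]) auto
    finally show ?thesis .
  qed
  then have "mat t t (\<lambda>(i, j). (A ^\<^sub>m i * M * A ^\<^sub>m j) $$ (0, 0)) = U * N * transpose_mat U"
    by (intro eq_matI) (use U N in \<open>auto simp del: index_mult_mat(1)\<close>)
  then show ?thesis
    using det_mult[of "U * N" t "transpose_mat U"] det_mult[OF U N] det_transpose[OF U] U N
    by (simp add: \<open>det U = 1\<close> N_def)
qed

lemma reverse_invariant_pow_mat:
  fixes A :: "'a::semiring_1 mat"
  assumes A: "A \<in> carrier_mat s s"
    and inv: "\<And>i j. i < s \<Longrightarrow> j < s \<Longrightarrow> A $$ (s - Suc i, s - Suc j) = A $$ (i, j)"
    and "i < s" "j < s"
  shows "(A ^\<^sub>m n) $$ (s - Suc i, s - Suc j) = (A ^\<^sub>m n) $$ (i, j)"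
  using \<open>i < s\<close> \<open>j < s\<close>
proof (induction n arbitrary: i j)
  case 0
  then show ?case using A by auto
next
  case (Suc n)
  have *: "(A ^\<^sub>m Suc n) $$ (a, b) = (\<Sum>c<s. (A ^\<^sub>m n) $$ (a, c) * A $$ (c, b))"
    if "a < s" "b < s" for a b
    using that A by (simp only: pow_mat.simps) (rule index_mult_mat_sum, auto)
  have "(A ^\<^sub>m Suc n) $$ (s - Suc i, s - Suc j) =
        (\<Sum>c<s. (A ^\<^sub>m n) $$ (s - Suc i, c) * A $$ (c, s - Suc j))"
    by (rule *) (use Suc.prems in auto)
  \<comment> \<open>Reversing the intermediate index too makes the invariance applicable to both
    factors.\<close>
  also have "\<dots> = (\<Sum>c<s. (A ^\<^sub>m n) $$ (s - Suc i, s - Suc c) * A $$ (s - Suc c, s - Suc j))"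
    by (rule sum.nat_diff_reindex[symmetric])
  also have "\<dots> = (\<Sum>c<s. (A ^\<^sub>m n) $$ (i, c) * A $$ (c, j))"
    by (intro sum.cong) (use Suc inv in auto)
  also have "\<dots> = (A ^\<^sub>m Suc n) $$ (i, j)"
    by (rule *[symmetric]) (use Suc.prems in auto)
  finally show ?case .
qed

section \<open>The transfer matrix of bounded Motzkin paths\<close>

text \<open>Entry \<open>(i, j)\<close> is the weight of a step from height \<open>i\<close> to
  height \<open>j\<close>. The heights are \<open>0, ..., s - 1\<close>, so the bound
  \<open>K\<close> on paths corresponds to \<open>s = Suc K\<close>.\<close>

definition transfer_mat :: "nat \<Rightarrow> (nat \<Rightarrow> 'a::comm_ring_1) \<Rightarrow> (nat \<Rightarrow> 'a) \<Rightarrow> 'a mat" where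
  "transfer_mat s b lam = mat s s (\<lambda>(i, j).
     if j = i then b i else if i = Suc j then lam i else if j = Suc i then 1 else 0)"

lemma transfer_mat_carrier [simp]: "transfer_mat s b lam \<in> carrier_mat s s"
  by (simp add: transfer_mat_def)

lemma path_weight_Cons:
  assumes "p \<noteq> []"
  shows "path_weight b lam (q # p) = step_weight b lam q (hd p) * path_weight b lam p"
proof -
  have "length (q # p) - 1 = Suc (length p - 1)"
    using assms by (cases p) auto
  then show ?thesis
    unfolding path_weight_def by (simp only: prod.lessThan_Suc_shift) (simp add: hd_conv_nth assms)
qed

text \<open>The starting point is left free because removing the first step of a path changes both
  of its coordinates.\<close>

definition walks :: "nat \<Rightarrow> int \<Rightarrow> nat \<Rightarrow> int \<Rightarrow> (int \<times> nat) list set" where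
  "walks K x h y =
     {p. motzkin_path p \<and> hd p = (x, h) \<and> last p = (y, 0) \<and> (\<forall>(x, h)\<in>set p. h \<le> K)}"

lemma walks_zero: "walks K x h x = (if h = 0 then {[(x, 0)]} else {})"
proof -
  have "p = [(x, 0)] \<and> h = 0" if "p \<in> walks K x h x" for p
  proof -
    have p: "successively motzkin_step p" "p \<noteq> []" "hd p = (x, h)" "last p = (x, 0)"
      using that by (auto simp: walks_def motzkin_path_def)
    then have "length p = 1"
      using motzkin_path_bounds[OF p(1,2)] by simp
    then show ?thesis
      using p by (cases p) auto
  qed
  then have "walks K x h x \<subseteq> (if h = 0 then {[(x, 0)]} else {})"
    by auto
  moreover have "[(x, 0)] \<in> walks K x 0 x"
    by (simp add: walks_def motzkin_path_def)
  ultimately show ?thesis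
    by (cases "h = 0") (simp_all, blast)
qed

lemma walks_Suc:
  assumes "h \<le> K"
  shows "walks K x h (x + int (Suc n)) =
    (\<Union>h'\<in>{h'. h' \<le> K \<and> (h' = h + 1 \<or> h' = h \<or> h = h' + 1)}.
       (#) (x, h) ` walks K (x + 1) h' (x + 1 + int n))" (is "?L = ?R")
proof (intro equalityI subsetI)
  fix p assume "p \<in> ?L"
  then have p: "successively motzkin_step p" "p \<noteq> []" "hd p = (x, h)"
    "last p = (x + int (Suc n), 0)" "\<forall>(x, h)\<in>set p. h \<le> K"
    by (auto simp: walks_def motzkin_path_def)
  obtain q where q: "p = (x, h) # q"
    using p by (cases p) auto
  with p(4) have "q \<noteq> []" by auto
  then obtain x' h' r where r: "q = (x', h') # r"
    by (metis list.exhaust surj_pair)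
  show "p \<in> ?R"
    using p q r by (auto simp: walks_def motzkin_path_def successively_Cons algebra_simps)
next
  fix p assume "p \<in> ?R"
  then obtain h' q where "p = (x, h) # q" "q \<in> walks K (x + 1) h' (x + 1 + int n)"
    "h' \<le> K" "h' = h + 1 \<or> h' = h \<or> h = h' + 1"
    by auto
  then show "p \<in> ?L"
    using assms by (auto simp: walks_def motzkin_path_def successively_Cons algebra_simps)
qed

text \<open>Induction on the length, splitting off the first step. Finiteness is carried along
  because splitting the sum over a union requires finite pieces.\<close>

lemma sum_walks:
  assumes "h \<le> K"
  shows "finite (walks K x h (x + int n)) \<and>
    (\<Sum>p\<in>walks K x h (x + int n). path_weight b lam p) = (transfer_mat (Suc K) b lam ^\<^sub>m n) $$ (h, 0)"
  using assms
proof (induction n arbitrary: x h)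
  case 0
  have [simp]: "dim_row (transfer_mat (Suc K) b lam) = Suc K"
    by (simp add: transfer_mat_def)
  show ?case
    using 0 by (auto simp: walks_zero path_weight_def)
next
  case (Suc n)
  define T where "T = transfer_mat (Suc K) b lam"
  have T: "T \<in> carrier_mat (Suc K) (Suc K)"
    by (simp add: T_def)
  let ?H = "{h'. h' \<le> K \<and> (h' = h + 1 \<or> h' = h \<or> h = h' + 1)}"
  let ?W = "\<lambda>h'. walks K (x + 1) h' (x + 1 + int n)"
  have fin: "finite (?W h')" if "h' \<in> ?H" for h'
    using Suc.IH that by auto
  have finH: "finite ?H"
    by (rule finite_subset[of _ "{..K}"]) auto
  have fin_Suc: "finite (walks K x h (x + int (Suc n)))"
    unfolding walks_Suc[OF Suc.prems] using fin finH by blast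
  \<comment> \<open>The pieces are disjoint: the second point of a path determines
    \<open>h'\<close>.\<close>
  have "(\<Sum>p\<in>walks K x h (x + int (Suc n)). path_weight b lam p) =
        (\<Sum>h'\<in>?H. \<Sum>p\<in>(#) (x, h) ` ?W h'. path_weight b lam p)"
    unfolding walks_Suc[OF Suc.prems] using fin finH
    by (intro sum.UNION_disjoint) (auto simp: walks_def)
  also have "\<dots> = (\<Sum>h'\<in>?H. T $$ (h, h') * (T ^\<^sub>m n) $$ (h', 0))"
  proof (rule sum.cong)
    fix h' assume h': "h' \<in> ?H"
    have "(\<Sum>p\<in>(#) (x, h) ` ?W h'. path_weight b lam p) =
          (\<Sum>p\<in>?W h'. path_weight b lam ((x, h) # p))"
      by (subst sum.reindex) (auto simp: inj_on_def)
    also have "\<dots> = (\<Sum>p\<in>?W h'. T $$ (h, h') * path_weight b lam p)"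
    proof (rule sum.cong)
      fix p assume "p \<in> ?W h'"
      then have "p \<noteq> []" "hd p = (x + 1, h')"
        by (auto simp: walks_def motzkin_path_def)
      then show "path_weight b lam ((x, h) # p) = T $$ (h, h') * path_weight b lam p"
        using h' Suc.prems by (auto simp: path_weight_Cons T_def transfer_mat_def)
    qed simp
    also have "\<dots> = T $$ (h, h') * (T ^\<^sub>m n) $$ (h', 0)"
      using Suc.IH[of h' "x + 1"] h' by (simp add: T_def flip: sum_distrib_left)
    finally show "(\<Sum>p\<in>(#) (x, h) ` ?W h'. path_weight b lam p) =
        T $$ (h, h') * (T ^\<^sub>m n) $$ (h', 0)" .
  qed simp
  also have "\<dots> = (\<Sum>h'<Suc K. T $$ (h, h') * (T ^\<^sub>m n) $$ (h', 0))"
    by (rule sum.mono_neutral_left) (use Suc.prems in \<open>auto simp: T_def transfer_mat_def\<close>)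
  also have "\<dots> = (T ^\<^sub>m Suc n) $$ (h, 0)"
    unfolding pow_mat_Suc_left[OF T]
    by (rule index_mult_mat_sum[symmetric]) (use T Suc.prems in auto)
  finally show ?case
    unfolding T_def using fin_Suc by blast
qed

lemma bounded_mu_eq_pow_transfer_mat:
  "bounded_mu K b lam N = (transfer_mat (Suc K) b lam ^\<^sub>m N) $$ (0, 0)"
  using sum_walks[of 0 K 0 N b lam] by (simp add: bounded_mu_def bounded_motzkin_paths_def walks_def)

section \<open>The case of unit weights\<close>

abbreviation unit_transfer_mat :: "nat \<Rightarrow> 'a::comm_ring_1 mat" where
  "unit_transfer_mat s \<equiv> transfer_mat s (\<lambda>_. 1) (\<lambda>_. 1)"

lemma unit_transfer_mat_index:
  "i < s \<Longrightarrow> j < s \<Longrightarrow>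
    unit_transfer_mat s $$ (i, j) = (if i \<le> Suc j \<and> j \<le> Suc i then 1 else 0)"
  by (auto simp: transfer_mat_def)

section \<open>Determinant of the unit transfer matrix\<close>

text \<open>Expand along the first row, which has two nonzero entries. The minor \<open>?M\<close>
  of the second one has a single nonzero entry in its first column, at the top, and is expanded
  along that column.\<close>

lemma det_unit_transfer_mat_Suc_Suc:
  "det (unit_transfer_mat (Suc (Suc s)) :: 'a::comm_ring_1 mat) =
   det (unit_transfer_mat (Suc s)) - det (unit_transfer_mat s)"
proof -
  let ?A = "unit_transfer_mat (Suc (Suc s)) :: 'a mat"
  let ?M = "mat_delete ?A 0 1"
  have M: "?M \<in> carrier_mat (Suc s) (Suc s)"
    using mat_delete_carrier[of ?A "Suc (Suc s)" "Suc (Suc s)"] by simp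
  have "mat_delete ?A 0 0 = unit_transfer_mat (Suc s)"
    by (rule eq_matI) (auto simp: mat_delete_def transfer_mat_def)
  moreover have "mat_delete ?M 0 0 = unit_transfer_mat s"
    by (rule eq_matI) (auto simp: mat_delete_def transfer_mat_def)
  moreover have "det ?M = det (mat_delete ?M 0 0)"
  proof -
    have "det ?M = (\<Sum>i<Suc s. ?M $$ (i, 0) * cofactor ?M i 0)"
      by (rule laplace_expansion_column[OF M]) simp
    also have "\<dots> = (\<Sum>i<Suc s. if i = 0 then cofactor ?M 0 0 else 0)"
      by (intro sum.cong) (auto simp: mat_delete_def transfer_mat_def)
    finally show ?thesis
      by (simp add: cofactor_def)
  qed
  moreover have "det ?A = det (mat_delete ?A 0 0) - det ?M"
  proof -
    have "det ?A = (\<Sum>j<Suc (Suc s). ?A $$ (0, j) * cofactor ?A 0 j)"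
      by (rule laplace_expansion_row) simp_all
    also have "\<dots> = (\<Sum>j\<in>{0, 1}. cofactor ?A 0 j)"
      by (rule sum.mono_neutral_cong_right) (auto simp: transfer_mat_def)
    finally show ?thesis
      by (simp add: cofactor_def)
  qed
  ultimately show ?thesis by simp
qed

text \<open>The characteristic roots of the preceding recurrence are the primitive sixth roots of
  unity, whose cubes are -1.\<close>

lemma det_unit_transfer_mat_period:
  "det (unit_transfer_mat (s + 3) :: 'a::comm_ring_1 mat) = - det (unit_transfer_mat s)"
  using det_unit_transfer_mat_Suc_Suc[of "Suc s", where 'a = 'a]
    det_unit_transfer_mat_Suc_Suc[of s, where 'a = 'a]
  by (simp add: numeral_3_eq_3)

lemma det_unit_transfer_mat:
  "det (unit_transfer_mat s :: 'a::comm_ring_1 mat) = (if s mod 3 = 2 then 0 else (-1) ^ (s div 3))"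
proof (induction s rule: less_induct)
  case (less s)
  have base: "det (unit_transfer_mat 0 :: 'a mat) = 1" "det (unit_transfer_mat 1 :: 'a mat) = 1"
    by (simp_all add: det_single transfer_mat_def)
  consider "s = 0" | "s = 1" | "s = 2" | "s \<ge> 3"
    by linarith
  then show ?case
  proof cases
    case 3
    then show ?thesis
      using det_unit_transfer_mat_Suc_Suc[of 0, where 'a = 'a] base by (simp add: numeral_2_eq_2)
  next
    case 4
    then obtain t where "s = t + 3"
      by (metis le_add_diff_inverse2)
    then show ?thesis
      using less[of t] by (simp add: det_unit_transfer_mat_period)
  qed (use base in auto)
qed

text \<open>
  Coefficients of the monic orthogonal polynomials \<open>P\<^sub>n\<close> of the unit weights: \<open>P\<^sub>n(A) e\<^sub>0 = e\<^sub>n\<close> for \<open>n < s\<close>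
  and \<open>P\<^sub>s(A) e\<^sub>0 = 0\<close>, which is the recurrence extending \<open>\<mu>\<close> to negative indices.
\<close>

fun ortho_coeff :: "nat \<Rightarrow> nat \<Rightarrow> 'a::comm_ring_1" where
  "ortho_coeff 0 i = (if i = 0 then 1 else 0)"
| "ortho_coeff (Suc 0) i = (if i = 0 then - 1 else if i = 1 then 1 else 0)"
| "ortho_coeff (Suc (Suc n)) i =
     (if i = 0 then 0 else ortho_coeff (Suc n) (i - 1)) - ortho_coeff (Suc n) i - ortho_coeff n i"

lemma ortho_coeff_eq_0: "n < i \<Longrightarrow> ortho_coeff n i = 0"
  by (induction n i rule: ortho_coeff.induct) auto

lemma ortho_coeff_lead: "ortho_coeff n n = 1"
proof (induction n rule: induct_nat_012)
  case (ge2 n)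
  then show ?case by (simp add: ortho_coeff_eq_0)
qed simp_all

text \<open>The polynomial is the characteristic polynomial of the transfer matrix, evaluated here
  at 0; both sides obey the same three-term recurrence. A nonzero value is what allows the
  recurrence to run backwards.\<close>

lemma ortho_coeff_const:
  "ortho_coeff n 0 = (-1) ^ n * det (unit_transfer_mat n :: 'a::comm_ring_1 mat)"
proof (induction n rule: induct_nat_012)
  case (ge2 n)
  then show ?case
    by (simp add: det_unit_transfer_mat_Suc_Suc algebra_simps)
qed (simp_all add: det_unit_transfer_mat)

text \<open>Think of \<open>G N\<close> as the first column of the \<open>N\<close>-th power of the
  transfer matrix, so that raising \<open>N\<close> by 1 applies the matrix. Solving
  \<open>step\<close> for its last term gives the recurrence of the coefficients. Summing up to
  \<open>s\<close> for every \<open>n\<close> lets the sums be combined termwise.\<close>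

lemma sum_ortho_coeff:
  fixes G :: "int \<Rightarrow> nat \<Rightarrow> 'a::comm_ring_1"
  assumes first: "\<And>N. G (N + 1) 0 = G N 0 + G N 1"
    and step: "\<And>N h. Suc h < s \<Longrightarrow> G (N + 1) (Suc h) = G N h + G N (Suc h) + G N (Suc (Suc h))"
    and "n \<le> s" "s \<ge> 1"
  shows "(\<Sum>i\<le>s. ortho_coeff n i * G (N + int i) 0) = G N n"
  using \<open>n \<le> s\<close>
proof (induction n arbitrary: N rule: induct_nat_012)
  case 0
  have "(\<Sum>i\<le>s. ortho_coeff 0 i * G (N + int i) 0) = (\<Sum>i\<le>s. if i = 0 then G N 0 else 0)"
    by (intro sum.cong) auto
  then show ?case by simp
next
  case 1
  have "(\<Sum>i\<le>s. ortho_coeff (Suc 0) i * G (N + int i) 0) =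
        (\<Sum>i\<in>{0, 1}. ortho_coeff (Suc 0) i * G (N + int i) 0)"
    by (rule sum.mono_neutral_right) (use \<open>s \<ge> 1\<close> in auto)
  then show ?case
    using first[of N] by simp
next
  case (ge2 n)
  let ?c = "ortho_coeff :: nat \<Rightarrow> nat \<Rightarrow> 'a"
  \<comment> \<open>The added term has coefficient \<open>?c (Suc n) s\<close>, which is 0 because
    \<open>Suc n < s\<close>.\<close>
  have "(\<Sum>i\<le>s. (if i = 0 then 0 else ?c (Suc n) (i - 1)) * G (N + int i) 0) =
        (\<Sum>i\<le>Suc s. (if i = 0 then 0 else ?c (Suc n) (i - 1)) * G (N + int i) 0)"
    using ge2.prems by (simp add: ortho_coeff_eq_0)
  also have "\<dots> = (\<Sum>i\<le>s. ?c (Suc n) i * G (N + 1 + int i) 0)"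
    unfolding sum.atMost_Suc_shift by (simp add: algebra_simps)
  also have "\<dots> = G (N + 1) (Suc n)"
    using ge2 by simp
  finally have "(\<Sum>i\<le>s. ?c (Suc (Suc n)) i * G (N + int i) 0) =
      G (N + 1) (Suc n) - G N (Suc n) - G N n"
    using ge2 by (simp add: left_diff_distrib sum_subtractf)
  also have "\<dots> = G N (Suc (Suc n))"
    using step[of n N] ge2.prems by simp
  finally show ?case .
qed

section \<open>Extension to negative indices by the inverse matrix\<close>

text \<open>Shift the relation by \<open>d\<close> and solve for its top term: the coefficients
  appear negated and in reverse order, so \<open>a 0\<close> becomes, up to sign, the last
  coefficient \<open>c d\<close>.\<close>

lemma recurrent_extensionI:
  fixes f :: "nat \<Rightarrow> 'a::field"
  assumes ext: "\<And>N. g (int N) = f N"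
    and rel: "\<And>N. (\<Sum>i\<le>d. a i * g (N + int i)) = 0"
    and "d \<ge> 1" "a d = 1" "a 0 \<noteq> 0"
  shows "recurrent_extension f g"
proof -
  define c where "c i = - a (d - i)" for i
  have rec: "g N = (\<Sum>i=1..d. c i * g (N - int i))" for N
  proof -
    have "0 = (\<Sum>i\<le>d. a i * g (N - int d + int i))"
      using rel by simp
    also have "\<dots> = (\<Sum>i<d. a i * g (N - int d + int i)) + g N"
      using \<open>a d = 1\<close> by (simp flip: lessThan_Suc_atMost)
    also have "(\<Sum>i<d. a i * g (N - int d + int i)) = (\<Sum>i=1..d. - (c i * g (N - int i)))"
      by (rule sum.reindex_bij_witness[of _ "\<lambda>i. d - i" "\<lambda>i. d - i"])
        (auto simp: c_def of_nat_diff algebra_simps)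
    finally show ?thesis
      by (simp add: sum_negf)
  qed
  have "f N = (\<Sum>i=1..d. c i * f (N - i))" if "N \<ge> d" for N
  proof -
    have "f N = (\<Sum>i=1..d. c i * g (int N - int i))"
      using rec[of "int N"] ext by simp
    also have "\<dots> = (\<Sum>i=1..d. c i * f (N - i))"
      by (intro sum.cong) (use that in \<open>auto simp flip: ext of_nat_diff\<close>)
    finally show ?thesis .
  qed
  moreover have "c d \<noteq> 0"
    using \<open>a 0 \<noteq> 0\<close> by (simp add: c_def)
  ultimately show ?thesis
    unfolding recurrent_extension_def using ext rec \<open>d \<ge> 1\<close> by blast
qed

lemma int_extension_eqI:
  assumes "recurrent_extension f g"
  shows "int_extension f = g"
  unfolding int_extension_def
  using assms by (blast intro: recurrent_extension_unique)

lemma bounded_mu_int_uminus: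
  fixes A' :: "'a::field mat" and K :: nat
  defines "A \<equiv> unit_transfer_mat (Suc K)"
  assumes A': "A' \<in> carrier_mat (Suc K) (Suc K)" and inv: "A * A' = 1\<^sub>m (Suc K)"
  shows "bounded_mu_int K (\<lambda>_. 1) (\<lambda>_. 1) (- int n) = (A' ^\<^sub>m n) $$ (0, 0)"
proof -
  define s where "s = Suc K"
  have A: "A \<in> carrier_mat s s" and A': "A' \<in> carrier_mat s s" and inv: "A * A' = 1\<^sub>m s"
    using assms by (simp_all add: s_def)
  \<comment> \<open>The integer powers of \<open>A\<close>, with \<open>A'\<close> as its
    inverse.\<close>
  define Z where "Z N = (if N \<ge> 0 then A ^\<^sub>m nat N else A' ^\<^sub>m nat (- N))" for N :: int
  \<comment> \<open>The value 0 for \<open>h \<ge> s\<close> is the upper boundary condition: it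
    makes the three-term rule hold at height \<open>s - 1\<close> as well.\<close>
  define G where "G N h = (if h < s then Z N $$ (h, 0) else 0)" for N h
  have Z: "Z N \<in> carrier_mat s s" for N
    using A A' by (simp add: Z_def)
  have Z_step: "Z (N + 1) = A * Z N" for N
  proof (cases "N \<ge> 0")
    case True
    then have "nat (N + 1) = Suc (nat N)" by simp
    with True show ?thesis
      using pow_mat_Suc_left[OF A] by (simp add: Z_def del: pow_mat.simps)
  next
    case False
    define l where "l = nat (- N) - 1"
    have N: "N = - int (Suc l)"
      using False by (simp add: l_def)
    have "A * A' ^\<^sub>m Suc l = A' ^\<^sub>m l"
      using pow_mat_cancel_left[OF A A' inv, of 1 "Suc l"] A
      by (simp del: pow_mat.simps(2) add: pow_mat.simps(2)[of A])
    \<comment> \<open>For \<open>l = 0\<close> the index \<open>N + 1\<close> is 0 and falls under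
      the other branch of \<open>Z\<close>; both branches give the identity there.\<close>
    moreover have "Z (N + 1) = A' ^\<^sub>m l"
      using A A' by (cases "l = 0") (auto simp: N Z_def)
    moreover have "Z N = A' ^\<^sub>m Suc l"
      by (simp only: N Z_def minus_minus nat_int) simp
    ultimately show ?thesis by simp
  qed
  have G_step: "G (N + 1) h = (\<Sum>c<s. A $$ (h, c) * G N c)" if "h < s" for N h
  proof -
    have "G (N + 1) h = (A * Z N) $$ (h, 0)"
      using that by (simp add: G_def Z_step)
    also have "\<dots> = (\<Sum>c<s. A $$ (h, c) * Z N $$ (c, 0))"
      using that A Z by (intro index_mult_mat_sum) (auto simp: s_def)
    finally show ?thesis
      by (simp add: G_def)
  qed
  \<comment> \<open>\<open>S\<close> contains \<open>s\<close> when \<open>h = s - 1\<close>; that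
    extra neighbour contributes 0.\<close>
  have G_extend: "(\<Sum>c<s. A $$ (h, c) * G N c) = (\<Sum>c\<in>S. G N c)"
    if "h < s" "S = {c. h \<le> Suc c \<and> c \<le> Suc h}" for h N S
  proof -
    have "finite S"
      by (rule finite_subset[of _ "{..Suc h}"]) (auto simp: that)
    have "(\<Sum>c<s. A $$ (h, c) * G N c) = (\<Sum>c<s. if c \<in> S then G N c else 0)"
      using that by (intro sum.cong) (auto simp: A_def unit_transfer_mat_index s_def)
    also have "\<dots> = (\<Sum>c\<in>{..<s} \<inter> S. G N c)"
      by (simp add: sum.inter_restrict)
    also have "\<dots> = (\<Sum>c\<in>S. G N c)"
      using \<open>finite S\<close> by (intro sum.mono_neutral_left) (auto simp: G_def)
    finally show ?thesis .
  qed
  have first: "G (N + 1) 0 = G N 0 + G N 1" for N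
  proof -
    have "{0, 1} = {c. 0 \<le> Suc c \<and> c \<le> Suc 0}" by auto
    from G_extend[OF _ this] show ?thesis
      using G_step[of 0 N] by (simp add: s_def)
  qed
  have step: "G (N + 1) (Suc h) = G N h + G N (Suc h) + G N (Suc (Suc h))" if "Suc h < s" for N h
  proof -
    have "{h, Suc h, Suc (Suc h)} = {c. Suc h \<le> Suc c \<and> c \<le> Suc (Suc h)}" by auto
    from G_extend[OF that this] show ?thesis
      using G_step[OF that, of N] by (simp add: add.assoc)
  qed
  have "det A * det A' = 1"
    using det_mult[OF A A'] inv by simp
  then have "ortho_coeff s 0 \<noteq> (0 :: 'a)"
    by (auto simp: ortho_coeff_const A_def s_def)
  \<comment> \<open>The sum equals \<open>G N s\<close>, which is 0 by the boundary
    condition.\<close>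
  moreover have "(\<Sum>i\<le>s. ortho_coeff s i * G (N + int i) 0) = 0" for N
    using sum_ortho_coeff[of G s s N, OF first step] by (simp add: s_def G_def)
  moreover have "G (int N) 0 = bounded_mu K (\<lambda>_. 1) (\<lambda>_. 1) N" for N
    by (simp add: G_def Z_def A_def s_def bounded_mu_eq_pow_transfer_mat)
  ultimately have "recurrent_extension (bounded_mu K (\<lambda>_. 1) (\<lambda>_. 1)) (\<lambda>N. G N 0)"
    by (intro recurrent_extensionI[where a = "ortho_coeff s" and d = s])
      (auto simp: ortho_coeff_lead s_def)
  then have "bounded_mu_int K (\<lambda>_. 1) (\<lambda>_. 1) (- int n) = G (- int n) 0"
    unfolding bounded_mu_int_def by (simp add: int_extension_eqI)
  also have "\<dots> = (A' ^\<^sub>m n) $$ (0, 0)"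
    using A A' by (cases "n = 0") (auto simp: G_def Z_def s_def)
  finally show ?thesis .
qed

section \<open>Comparison of the two Hankel determinants\<close>

theorem theorem1p5:
  fixes n k m :: nat
  assumes "n > 0" and "k > 0" and "m > 0"
    and "(k + m) mod 3 \<noteq> 2"
  shows "det (mat k k (\<lambda>(i, j).
             bounded_mu (k + m - 1) (\<lambda>_. 1) (\<lambda>_. 1) (n + i + j + 2 * m - 2) :: rat))
       = (-1) ^ (n * ((k + m) div 3)) *
         det (mat m m (\<lambda>(i, j).
             bounded_mu_int (k + m - 1) (\<lambda>_. 1) (\<lambda>_. 1) (- int n - int i - int j)))"
proof -
  define s where "s = k + m"
  define A :: "rat mat" where "A = unit_transfer_mat s"
  \<comment> \<open>The exponent \<open>n + 2 * m - 2\<close>, written with the even summand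
    \<open>2 * (m - 1)\<close> that will drop out of the sign.\<close>
  define r where "r = n + 2 * (m - 1)"
  have s: "Suc (k + m - 1) = s"
    using \<open>k > 0\<close> by (simp add: s_def)
  have A: "A \<in> carrier_mat s s"
    by (simp add: A_def)
  have det_A: "det A = (-1) ^ (s div 3)"
    using assms by (simp add: A_def det_unit_transfer_mat s_def)
  then obtain A' where A': "A' \<in> carrier_mat s s" "A' * A = 1\<^sub>m s" "A * A' = 1\<^sub>m s"
    using det_non_zero_imp_unit[OF A, of "()"] by (auto simp: Units_def ring_mat_def)
  have sym: "transpose_mat A = A"
    by (rule eq_matI) (auto simp: A_def unit_transfer_mat_index transfer_mat_def)
  have zero: "A $$ (i, j) = 0" if "i < s" "j < s" "Suc i < j" for i j
    using that by (simp add: A_def unit_transfer_mat_index)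
  have one: "A $$ (i, Suc i) = 1" if "Suc i < s" for i
    using that by (simp add: A_def unit_transfer_mat_index)
  have rev: "A $$ (s - Suc i, s - Suc j) = A $$ (i, j)" if "i < s" "j < s" for i j
    using that by (auto simp: A_def unit_transfer_mat_index)
  note krylov = det_krylov[OF A sym zero one]
  define B where "B = A ^\<^sub>m r"
  define C where "C = A' ^\<^sub>m r"
  have B: "B \<in> carrier_mat s s" and C: "C \<in> carrier_mat s s"
    using A A' by (simp_all add: B_def C_def)
  have "C * B = 1\<^sub>m s"
    using pow_mat_cancel_left[OF A'(1) A A'(2), of r r] A by (simp add: B_def C_def)

  have "det (mat k k (\<lambda>(i, j). bounded_mu (k + m - 1) (\<lambda>_. 1) (\<lambda>_. 1) (n + i + j + 2 * m - 2)))
      = det (mat k k (\<lambda>(i, j). (A ^\<^sub>m i * B * A ^\<^sub>m j) $$ (0, 0)))"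
  proof (intro arg_cong[of _ _ det] cong_mat refl)
    fix i j
    have "n + i + j + 2 * m - 2 = i + r + j"
      using \<open>m > 0\<close> by (simp add: r_def)
    then show "(case (i, j) of (i, j) \<Rightarrow>
        bounded_mu (k + m - 1) (\<lambda>_. 1) (\<lambda>_. 1) (n + i + j + 2 * m - 2)) =
        (case (i, j) of (i, j) \<Rightarrow> (A ^\<^sub>m i * B * A ^\<^sub>m j) $$ (0, 0))"
      by (simp only: prod.case bounded_mu_eq_pow_transfer_mat s pow_mat_add[OF A] B_def flip: A_def)
  qed
  also have "\<dots> = det (mat k k (\<lambda>(i, j). B $$ (i, j)))"
    by (rule krylov) (use B in \<open>auto simp: s_def\<close>)
  also have "\<dots> = det (mat k k (\<lambda>(i, j). B $$ (k - Suc i, k - Suc j)))"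
    by (rule det_reverse[symmetric])
  \<comment> \<open>As \<open>s - Suc (m + i) = k - Suc i\<close>, reversing the whole basis carries
    the reversed leading block to the trailing one.\<close>
  also have "\<dots> = det (mat k k (\<lambda>(i, j). B $$ (m + i, m + j)))"
  proof (intro arg_cong[of _ _ det] cong_mat refl)
    fix i j assume ij: "i < k" "j < k"
    then have "B $$ (s - Suc (m + i), s - Suc (m + j)) = B $$ (m + i, m + j)"
      unfolding B_def by (intro reverse_invariant_pow_mat[OF A rev]) (auto simp: s_def)
    then show "(case (i, j) of (i, j) \<Rightarrow> B $$ (k - Suc i, k - Suc j)) =
        (case (i, j) of (i, j) \<Rightarrow> B $$ (m + i, m + j))"
      by (simp add: s_def)
  qed
  also have "\<dots> = det (mat m m (\<lambda>(i, j). C $$ (i, j))) * det B"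
    using jacobi_complementary_minor[of B m k C] B C \<open>C * B = 1\<^sub>m s\<close>
    by (simp add: s_def add.commute)
  \<comment> \<open>\<open>det A\<close> is a sign and \<open>r\<close> has the parity of
    \<open>n\<close>.\<close>
  also have "det B = (-1) ^ (n * ((k + m) div 3))"
    by (simp add: B_def det_pow_mat[OF A] det_A r_def s_def power_add power_mult mult.commute
        flip: power_mult)
  also have "det (mat m m (\<lambda>(i, j). C $$ (i, j))) =
      det (mat m m (\<lambda>(i, j). (A ^\<^sub>m i * C * A ^\<^sub>m j) $$ (0, 0)))"
    by (rule krylov[symmetric]) (use C in \<open>auto simp: s_def\<close>)
  \<comment> \<open>The factors \<open>A\<close> cancel against \<open>C\<close>, leaving the
    exponent \<open>r - i - j\<close> of \<open>A'\<close>. The summand \<open>2 * (m - 1)\<close>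
    of \<open>r\<close> splits evenly between row and column, which gives the reversed
    indices.\<close>
  also have "\<dots> = det (mat m m (\<lambda>(i, j).
      bounded_mu_int (k + m - 1) (\<lambda>_. 1) (\<lambda>_. 1) (- int n - int (m - Suc i) - int (m - Suc j))))"
  proof (intro arg_cong[of _ _ det] cong_mat refl)
    fix i j assume ij: "i < m" "j < m"
    then have "i \<le> r" "j \<le> r - i"
      by (simp_all add: r_def)
    then have "A ^\<^sub>m i * C * A ^\<^sub>m j = A' ^\<^sub>m (r - i - j)"
      using pow_mat_cancel_left[OF A A'(1,3)] pow_mat_cancel_right[OF A A'(1,2)]
      by (simp add: C_def)
    also have "r - i - j = n + (m - Suc i) + (m - Suc j)"
      using ij by (simp add: r_def)
    finally show "(case (i, j) of (i, j) \<Rightarrow> (A ^\<^sub>m i * C * A ^\<^sub>m j) $$ (0, 0)) =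
        (case (i, j) of (i, j) \<Rightarrow> bounded_mu_int (k + m - 1) (\<lambda>_. 1) (\<lambda>_. 1)
          (- int n - int (m - Suc i) - int (m - Suc j)))"
      using bounded_mu_int_uminus[of A' "k + m - 1" "n + (m - Suc i) + (m - Suc j)"] A'
      by (simp only: s flip: A_def) (simp add: algebra_simps)
  qed
  also have "\<dots> = det (mat m m (\<lambda>(i, j).
      bounded_mu_int (k + m - 1) (\<lambda>_. 1) (\<lambda>_. 1) (- int n - int i - int j)))"
    by (rule det_reverse[where f = "\<lambda>i j.
        bounded_mu_int (k + m - 1) (\<lambda>_. 1) (\<lambda>_. 1) (- int n - int i - int j)"])
  finally show ?thesis
    by (simp only: mult.commute)
qed

end
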